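(* Let $M\ge3$ be an integer and let $\mathcal{A},\mathcal{B}\subset\{0,1,\dots,M-1\}$ with $1<|\mathcal{A}|=|\mathcal{B}|<M$. If $(\mathcal{A},\mathcal{B})$ is a spectral pair in $\mathbb{Z}_{M^2}$, then $|\mathcal{A}|=|\mathcal{B}|=2$.
   Context: Spectral pair: for an integer $N\ge1$, $(\mathcal{A},\mathcal{B})$ with $|\mathcal{A}|=|\mathcal{B}|$ is a spectral pair in $\mathbb{Z}_N$ if the matrix $\frac{1}{\sqrt{|\mathcal{A}|}}\left(e^{2\pi i ab/N}\right)_{a\in\mathcal{A},b\in\mathcal{B}}$ is unitary. *)

theory Defs
  imports Complex_Main
begin

text \<open>
  Matrices here have rows and columns indexed by arbitrary finite sets of equal size
  (for which there is no canonical bijection with \<open>{0..<n}\<close>), so they are plain functions.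
  The two conjuncts are the entrywise forms of $U U^* = I$ and $U^* U = I$.
\<close>

definition unitary_on :: "'a set \<Rightarrow> 'b set \<Rightarrow> ('a \<Rightarrow> 'b \<Rightarrow> complex) \<Rightarrow> bool" where
  "unitary_on A B U \<longleftrightarrow>
     finite A \<and> finite B \<and> card A = card B \<and>
     (\<forall>a\<in>A. \<forall>a'\<in>A. (\<Sum>b\<in>B. U a b * cnj (U a' b)) = (if a = a' then 1 else 0)) \<and>
     (\<forall>b\<in>B. \<forall>b'\<in>B. (\<Sum>a\<in>A. cnj (U a b) * U a b') = (if b = b' then 1 else 0))"

definition fourier_submatrix :: "nat \<Rightarrow> nat set \<Rightarrow> nat \<Rightarrow> nat \<Rightarrow> complex" where
  "fourier_submatrix N A a b =
     1 / complex_of_real (sqrt (real (card A))) *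
     exp (2 * complex_of_real pi * \<i> * of_nat a * of_nat b / of_nat N)"

text \<open>Elements of $\mathbb{Z}_N$ are represented by their residues in \<open>{0..<N}\<close>.\<close>

definition spectral_pair :: "nat \<Rightarrow> nat set \<Rightarrow> nat set \<Rightarrow> bool" where
  "spectral_pair N A B \<longleftrightarrow>
     N \<ge> 1 \<and> A \<subseteq> {0..<N} \<and> B \<subseteq> {0..<N} \<and> card A = card B \<and>
     unitary_on A B (fourier_submatrix N A)"

end

theory Submission
  imports Defs
begin

text \<open>
  Suppose the common size were at least three.  Two elements of \<open>A\<close> then lie in the same
  half of \<open>{0..<M}\<close>, so their difference \<open>d\<close> satisfies \<open>0 < d < M / 2\<close>
  (lemma \<open>exists_close_pair\<close>).  Orthogonality of the two corresponding rows says that the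
  points $e^{2\pi i d b / M^2}$, $b \in B$, sum to zero.  But every \<open>b \<in> B\<close> is below \<open>M\<close>, so
  the angles $2\pi d b / M^2$ all lie in $[0, \pi)$: the points lie in the closed upper half
  plane, and every \<open>b > 0\<close> gives a point strictly inside it.  As \<open>B\<close> has a nonzero element,
  the sum has positive imaginary part, a contradiction.
\<close>

lemma exists_close_pair:
  fixes A :: "nat set" and M :: nat
  assumes "A \<subseteq> {..<M}" and "card A > 2"
  obtains x y where "x \<in> A" "y \<in> A" "x < y" "2 * (y - x) < M"
proof -
  \<comment> \<open>The map \<open>x \<mapsto> 2 * x div M\<close> tells the lower half of \<open>{..<M}\<close> from the upper half.\<close>
  let ?half = "\<lambda>x. 2 * x div M"
  have "?half ` A \<subseteq> {..<2}"
    using assms(1) by (auto simp: less_mult_imp_div_less)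
  then have "card (?half ` A) \<le> card {..<2::nat}"
    by (rule card_mono[OF finite_lessThan])
  then have "\<not> inj_on ?half A"
    using assms(2) by (intro pigeonhole) simp
  then obtain x y where xy: "x \<in> A" "y \<in> A" "x < y" "?half x = ?half y"
    unfolding inj_on_def by (metis linorder_neqE_nat)
  have "M > 0"
    using xy assms(1) by auto
  have "2 * y = ?half x * M + 2 * y mod M"
    using xy(4) by (metis div_mult_mod_eq)
  moreover have "?half x * M \<le> 2 * x"
    by simp
  moreover have "2 * y mod M < M"
    using \<open>M > 0\<close> by simp
  ultimately have "2 * (y - x) < M"
    by linarith
  with xy show thesis
    using that by blast
qed

lemma fourier_submatrix_mult_cnj:
  assumes "x \<le> y"
  shows "fourier_submatrix N A y b * cnj (fourier_submatrix N A x b) =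
         of_real (1 / real (card A)) * cis (2 * pi * real (y - x) * real b / real N)"
proof -
  have entry: "fourier_submatrix N A z b =
      of_real (1 / sqrt (real (card A))) * cis (2 * pi * real z * real b / real N)" for z
    by (simp add: fourier_submatrix_def cis_conv_exp mult_ac)
  have "2 * pi * real y * real b / real N - 2 * pi * real x * real b / real N =
        2 * pi * real (y - x) * real b / real N"
    using assms by (simp add: of_nat_diff algebra_simps diff_divide_distrib)
  then have "cis (2 * pi * real y * real b / real N) * cnj (cis (2 * pi * real x * real b / real N))
      = cis (2 * pi * real (y - x) * real b / real N)"
    by (simp add: cis_cnj cis_mult)
  moreover have "of_real (1 / sqrt (real (card A))) * of_real (1 / sqrt (real (card A))) =
      (of_real (1 / real (card A)) :: complex)"
    by (simp flip: of_real_mult)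
  moreover have "(r * u) * (r * v) = (r * r) * (u * v)" for r u v :: complex
    by (simp add: mult_ac)
  ultimately show ?thesis
    by (simp only: entry complex_cnj_mult complex_cnj_complex_of_real)
qed

text \<open>
  The angles increase with \<open>b\<close> and stay below \<open>\<pi>\<close>, so no point lies in the open lower half
  plane and the only one on the real axis is the one for \<open>b = 0\<close>.
\<close>

lemma Im_sum_cis_pos:
  fixes B :: "nat set" and t :: real
  assumes "finite B" and "t > 0" and "\<And>b. b \<in> B \<Longrightarrow> t * real b < pi"
    and "c \<in> B" and "c > 0"
  shows "Im (\<Sum>b\<in>B. cis (t * real b)) > 0"
proof -
  have "(\<Sum>b\<in>B. sin (t * real b)) > 0"
  proof (rule sum_pos2)
    show "0 < sin (t * real c)"
      using assms by (intro sin_gt_zero) auto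
    show "0 \<le> sin (t * real b)" if "b \<in> B" for b
      using assms(2) assms(3)[OF that] by (intro sin_ge_zero) auto
  qed (use assms in auto)
  then show ?thesis
    by simp
qed

theorem proposition3p1:
  fixes M :: nat and A B :: "nat set"
  assumes "M \<ge> 3"
    and "A \<subseteq> {0..M - 1}" and "B \<subseteq> {0..M - 1}"
    and "1 < card A" and "card A = card B" and "card B < M"
    and "spectral_pair (M ^ 2) A B"
  shows "card A = 2 \<and> card B = 2"
proof (rule ccontr)
  assume "\<not> ?thesis"
  then have "card A > 2"
    using assms by linarith
  moreover have "A \<subseteq> {..<M}"
    using assms(1,2) by fastforce
  ultimately obtain x y where xy: "x \<in> A" "y \<in> A" "x < y" "2 * (y - x) < M"
    using exists_close_pair by metis
  define t where "t = 2 * pi * real (y - x) / real (M ^ 2)"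
  have "finite B"
    using assms(3) finite_subset by blast
  have "t > 0"
    using xy assms(1) by (simp add: t_def)
  have angle: "t * real b < pi" if "b \<in> B" for b
  proof -
    have "b < M"
      using that assms(1,3) by fastforce
    then have "2 * (y - x) * b < M * M"
      using xy(4) by (intro mult_strict_mono) auto
    then have "real (2 * (y - x) * b) < real (M ^ 2)"
      unfolding power2_eq_square of_nat_less_iff .
    then have "pi * real (2 * (y - x) * b) < pi * real (M ^ 2)"
      by simp
    moreover have "t * real b = pi * real (2 * (y - x) * b) / real (M ^ 2)"
      by (simp add: t_def)
    ultimately show ?thesis
      using assms(1) by (simp add: pos_divide_less_eq)
  qed
  obtain c where c: "c \<in> B" "c > 0"
  proof -
    have "\<not> B \<subseteq> {0}"
      using card_mono[of "{0}" B] assms(4,5) by auto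
    then show thesis
      using that by auto
  qed
  have "(\<Sum>b\<in>B. fourier_submatrix (M ^ 2) A y b * cnj (fourier_submatrix (M ^ 2) A x b)) = 0"
    using assms(7) xy unfolding spectral_pair_def unitary_on_def by auto
  then have "of_real (1 / real (card A)) * (\<Sum>b\<in>B. cis (t * real b)) = 0"
    using xy(3) by (simp add: fourier_submatrix_mult_cnj sum_distrib_left t_def)
  then have "(\<Sum>b\<in>B. cis (t * real b)) = 0"
    using assms(4) by auto
  then show False
    using Im_sum_cis_pos[OF \<open>finite B\<close> \<open>t > 0\<close> angle c] by simp
qed

end
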